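(* Let $J:\mathbb{R}^n\to\mathbb{R}$ be a continuous convex function, $A\in\mathbb{R}^{m\times n}$, $b\in\mathbb{R}^m$, $\mu>0$, $\tau>0$, and let $\{\alpha_k\}_{k\ge0}$ be a sequence of real numbers. Let $\{x^k\}$ be generated by the accelerated linearized Bregman method: $x^0=\tilde x^0=\tilde p^0=p^0=0$ and for $k=0,1,\dots$ $$x^{k+1}=\arg\min_{x}\; D_J^{\tilde p^k}(x,\tilde x^k)+\tau\langle A^\top(A\tilde x^k-b),x\rangle+\tfrac1{2\mu}\|x-\tilde x^k\|^2,$$ $$p^{k+1}=\tilde p^k-\tau A^\top(A\tilde x^k-b)-\tfrac1\mu(x^{k+1}-\tilde x^k),$$ $$\tilde x^{k+1}=\alpha_kx^{k+1}+(1-\alpha_k)x^k,\qquad \tilde p^{k+1}=\alpha_kp^{k+1}+(1-\alpha_k)p^k.$$ Let $\{w^k\}$ be generated by the accelerated dual gradient descent method: $\tilde y^0=y^0=\tau b$ and for $k=0,1,\dots$ $$w^{k+1}=\arg\min_{w}\; J(w)+\tfrac1{2\mu}\|w\|^2-\langle\tilde y^k,Aw-b\rangle,$$ $$y^{k+1}=\tilde y^k-\tau(Aw^{k+1}-b),\qquad \tilde y^{k+1}=\alpha_ky^{k+1}+(1-\alpha_k)y^k.$$ Then the two methods are equivalent in the sense that the sequence $\{x^k\}$ is exactly the same as the sequence $\{w^k\}$: $x^k=w^k$ for all $k\ge1$.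
   Context: $\|\cdot\|$ is the Euclidean norm and $\langle\cdot,\cdot\rangle$ the standard inner product. For vectors $u,v,p\in\mathbb{R}^n$, $D_J^p(u,v):=J(u)-J(v)-\langle p,u-v\rangle$. The minimizers in both algorithms are unique because the objectives are strongly convex. *)

theory Defs
  imports "HOL-Analysis.Analysis"
begin

definition bregman_dist ::
  "('a::real_inner \<Rightarrow> real) \<Rightarrow> 'a \<Rightarrow> 'a \<Rightarrow> 'a \<Rightarrow> real" where
  "bregman_dist J p u v = J u - J v - p \<bullet> (u - v)"

text \<open>The two iterations are given as predicates on sequences. The updates by minimization say
  that the new iterate is a minimizer over the whole space; for continuous convex \<open>J\<close> and
  \<open>\<mu> > 0\<close> the objectives are strongly convex, so that this determines the iterate.\<close>

definition accelerated_linearized_bregman ::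
  "(real^'n \<Rightarrow> real) \<Rightarrow> real^'n^'m \<Rightarrow> real^'m \<Rightarrow> real \<Rightarrow> real \<Rightarrow> (nat \<Rightarrow> real) \<Rightarrow>
   (nat \<Rightarrow> real^'n) \<Rightarrow> (nat \<Rightarrow> real^'n) \<Rightarrow> (nat \<Rightarrow> real^'n) \<Rightarrow> (nat \<Rightarrow> real^'n) \<Rightarrow> bool" where
  "accelerated_linearized_bregman J A b \<mu> \<tau> \<alpha> x xt p pt \<longleftrightarrow>
     x 0 = 0 \<and> xt 0 = 0 \<and> pt 0 = 0 \<and> p 0 = 0 \<and>
     (\<forall>k.
       is_arg_min
         (\<lambda>z. bregman_dist J (pt k) z (xt k)
              + \<tau> * ((transpose A *v (A *v xt k - b)) \<bullet> z)
              + 1 / (2 * \<mu>) * (norm (z - xt k))\<^sup>2)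
         (\<lambda>_. True) (x (Suc k)) \<and>
       p (Suc k) = pt k - \<tau> *\<^sub>R (transpose A *v (A *v xt k - b))
                   - (1 / \<mu>) *\<^sub>R (x (Suc k) - xt k) \<and>
       xt (Suc k) = \<alpha> k *\<^sub>R x (Suc k) + (1 - \<alpha> k) *\<^sub>R x k \<and>
       pt (Suc k) = \<alpha> k *\<^sub>R p (Suc k) + (1 - \<alpha> k) *\<^sub>R p k)"

text \<open>The dual method produces \<open>w k\<close> only for \<open>k \<ge> 1\<close>; the value \<open>w 0\<close> is left unconstrained.\<close>

definition accelerated_dual_gradient_descent ::
  "(real^'n \<Rightarrow> real) \<Rightarrow> real^'n^'m \<Rightarrow> real^'m \<Rightarrow> real \<Rightarrow> real \<Rightarrow> (nat \<Rightarrow> real) \<Rightarrow>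
   (nat \<Rightarrow> real^'n) \<Rightarrow> (nat \<Rightarrow> real^'m) \<Rightarrow> (nat \<Rightarrow> real^'m) \<Rightarrow> bool" where
  "accelerated_dual_gradient_descent J A b \<mu> \<tau> \<alpha> w y yt \<longleftrightarrow>
     yt 0 = \<tau> *\<^sub>R b \<and> y 0 = \<tau> *\<^sub>R b \<and>
     (\<forall>k.
       is_arg_min
         (\<lambda>z. J z + 1 / (2 * \<mu>) * (norm z)\<^sup>2 - yt k \<bullet> (A *v z - b))
         (\<lambda>_. True) (w (Suc k)) \<and>
       y (Suc k) = yt k - \<tau> *\<^sub>R (A *v w (Suc k) - b) \<and>
       yt (Suc k) = \<alpha> k *\<^sub>R y (Suc k) + (1 - \<alpha> k) *\<^sub>R y k)"

end

theory Submission
  imports Defs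
begin

text \<open>
  Both minimization steps minimize the same function up to an additive constant. Expanding
  the square in the Bregman step shows that its objective is
  \<open>J z + (norm z)\<^sup>2 / (2 \<mu>) - c \<bullet> z\<close> plus a constant, where
  \<open>c = pt k + xt k / \<mu> - \<tau> A\<^sup>T (A (xt k) - b)\<close>; the dual step minimizes this function with
  \<open>c = A\<^sup>T (yt k)\<close> (\<open>bregman_step_objective\<close>, \<open>dual_step_objective\<close>). A minimizer is determined
  by \<open>c\<close>, as the function is strongly convex (\<open>is_arg_min_regularized_unique\<close>).

  The two vectors \<open>c\<close> agree by induction. The invariant is that the relation
  \<open>A\<^sup>T y = p + x / \<mu> - \<tau> A\<^sup>T (A x - b)\<close> holds both for \<open>(x k, p k, y k)\<close> and for the
  extrapolated triple \<open>(xt k, pt k, yt k)\<close>. The latter makes the next primal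
  iterates coincide; then the definitions of \<open>p (Suc k)\<close> and \<open>y (Suc k)\<close> give the relation at
  \<open>Suc k\<close>. The relation is affine in \<open>(x, p, y)\<close>, and the extrapolation weights \<open>\<alpha> k\<close> and
  \<open>1 - \<alpha> k\<close> sum to one, so it passes to the extrapolated triple.
\<close>

text \<open>
  Strong convexity: if two minimizers were distinct, the parallelogram identity would make the
  objective at their midpoint smaller by a positive multiple of their squared distance.
\<close>

lemma is_arg_min_regularized_unique:
  fixes J :: "'a::real_inner \<Rightarrow> real"
  assumes J: "convex_on UNIV J" and "c > 0"
    and u: "is_arg_min (\<lambda>z. J z + c * (norm z)\<^sup>2 - q \<bullet> z) (\<lambda>_. True) u"
    and v: "is_arg_min (\<lambda>z. J z + c * (norm z)\<^sup>2 - q \<bullet> z) (\<lambda>_. True) v"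
  shows "u = v"
proof -
  define m where "m = (1/2) *\<^sub>R u + (1/2) *\<^sub>R v"
  have "J m \<le> (1/2) * J u + (1/2) * J v"
    using convex_onD[OF J, of "1/2" u v] by (simp add: m_def)
  moreover have "(norm m)\<^sup>2 = (norm u)\<^sup>2 / 2 + (norm v)\<^sup>2 / 2 - (norm (u - v))\<^sup>2 / 4"
    unfolding m_def power2_norm_eq_inner
    by (simp add: inner_simps inner_commute field_simps)
  then have "c * (norm m)\<^sup>2
      = c * (norm u)\<^sup>2 / 2 + c * (norm v)\<^sup>2 / 2 - c * (norm (u - v))\<^sup>2 / 4"
    by (simp only: right_diff_distrib distrib_left times_divide_eq_right)
  moreover have "q \<bullet> m = (q \<bullet> u) / 2 + (q \<bullet> v) / 2"
    by (simp add: m_def inner_simps)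
  moreover have "J u + c * (norm u)\<^sup>2 - q \<bullet> u \<le> J m + c * (norm m)\<^sup>2 - q \<bullet> m"
    using u by (simp add: is_arg_min_linorder)
  moreover have "J v + c * (norm v)\<^sup>2 - q \<bullet> v \<le> J m + c * (norm m)\<^sup>2 - q \<bullet> m"
    using v by (simp add: is_arg_min_linorder)
  ultimately have "c * (norm (u - v))\<^sup>2 \<le> 0"
    by linarith
  then show ?thesis
    using \<open>c > 0\<close> by (simp add: mult_le_0_iff)
qed

lemma is_arg_min_add_const:
  fixes f :: "'a \<Rightarrow> real"
  shows "is_arg_min (\<lambda>z. f z + d) P u \<longleftrightarrow> is_arg_min f P u"
  by (simp add: is_arg_min_def)

text \<open>
  Expanding the proximal square moves its cross term \<open>- (v \<bullet> z) / \<mu>\<close> into the linear part.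
\<close>

lemma bregman_step_objective:
  fixes J :: "'a::real_inner \<Rightarrow> real"
  shows "bregman_dist J p z v + \<tau> * (g \<bullet> z) + 1 / (2 * \<mu>) * (norm (z - v))\<^sup>2
    = (J z + 1 / (2 * \<mu>) * (norm z)\<^sup>2 - (p + (1 / \<mu>) *\<^sub>R v - \<tau> *\<^sub>R g) \<bullet> z)
      + (p \<bullet> v - J v + 1 / (2 * \<mu>) * (norm v)\<^sup>2)"
proof -
  have "(norm (z - v))\<^sup>2 = (norm z)\<^sup>2 - 2 * (v \<bullet> z) + (norm v)\<^sup>2"
    unfolding power2_norm_eq_inner by (simp add: inner_simps inner_commute)
  then have "1 / (2 * \<mu>) * (norm (z - v))\<^sup>2
      = 1 / (2 * \<mu>) * (norm z)\<^sup>2 - (1 / \<mu>) * (v \<bullet> z) + 1 / (2 * \<mu>) * (norm v)\<^sup>2"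
    by (cases "\<mu> = 0") (simp_all add: field_simps)
  then show ?thesis
    by (simp add: bregman_dist_def inner_simps)
qed

lemma dual_step_objective:
  fixes A :: "real^'n^'m"
  shows "J z + d - y \<bullet> (A *v z - b) = (J z + d - (transpose A *v y) \<bullet> z) + y \<bullet> b"
proof -
  have "y \<bullet> (A *v z) = (transpose A *v y) \<bullet> z"
    by (simp add: dot_lmul_matrix)
  then show ?thesis
    by (simp add: inner_diff_right)
qed

text \<open>
  The relation coupling a primal pair \<open>(x, p)\<close> of the Bregman method to a dual point \<open>y\<close> of the
  gradient method: the linear terms of the two minimization problems built from them agree.
\<close>

definition coupled ::
  "real^'n^'m \<Rightarrow> real^'m \<Rightarrow> real \<Rightarrow> real \<Rightarrow> real^'n \<Rightarrow> real^'n \<Rightarrow> real^'m \<Rightarrow> bool" where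
  "coupled A b \<mu> \<tau> x p y \<longleftrightarrow>
     transpose A *v y = p + (1 / \<mu>) *\<^sub>R x - \<tau> *\<^sub>R (transpose A *v (A *v x - b))"

lemma coupled_affine_combination:
  assumes "coupled A b \<mu> \<tau> x p y" and "coupled A b \<mu> \<tau> x' p' y'"
  shows "coupled A b \<mu> \<tau> (a *\<^sub>R x + (1 - a) *\<^sub>R x') (a *\<^sub>R p + (1 - a) *\<^sub>R p')
    (a *\<^sub>R y + (1 - a) *\<^sub>R y')"
proof -
  have "A *v (a *\<^sub>R x + (1 - a) *\<^sub>R x') - b
      = a *\<^sub>R (A *v x - b) + (1 - a) *\<^sub>R (A *v x' - b)"
    by (simp add: matrix_vector_right_distrib matrix_vector_mult_scaleR algebra_simps)
  then have "transpose A *v (A *v (a *\<^sub>R x + (1 - a) *\<^sub>R x') - b)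
      = a *\<^sub>R (transpose A *v (A *v x - b)) + (1 - a) *\<^sub>R (transpose A *v (A *v x' - b))"
    by (simp only: matrix_vector_right_distrib matrix_vector_mult_scaleR)
  moreover have "transpose A *v (a *\<^sub>R y + (1 - a) *\<^sub>R y')
      = a *\<^sub>R (transpose A *v y) + (1 - a) *\<^sub>R (transpose A *v y')"
    by (simp only: matrix_vector_right_distrib matrix_vector_mult_scaleR)
  ultimately show ?thesis
    unfolding coupled_def
    by (simp only: assms[unfolded coupled_def]) (simp add: algebra_simps diff_divide_distrib)
qed

text \<open>
  By coupling, the two objectives differ only by a constant.
\<close>

lemma coupled_minimizers_eq:
  assumes "convex_on UNIV J" and "\<mu> > 0" and "coupled A b \<mu> \<tau> v p y"
    and u: "is_arg_min (\<lambda>z. bregman_dist J p z v + \<tau> * ((transpose A *v (A *v v - b)) \<bullet> z)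
               + 1 / (2 * \<mu>) * (norm (z - v))\<^sup>2) (\<lambda>_. True) u"
    and w: "is_arg_min (\<lambda>z. J z + 1 / (2 * \<mu>) * (norm z)\<^sup>2 - y \<bullet> (A *v z - b)) (\<lambda>_. True) w"
  shows "u = w"
proof (rule is_arg_min_regularized_unique)
  show "is_arg_min (\<lambda>z. J z + 1 / (2 * \<mu>) * (norm z)\<^sup>2 - (transpose A *v y) \<bullet> z) (\<lambda>_. True) u"
    using u \<open>coupled A b \<mu> \<tau> v p y\<close>
    by (simp only: bregman_step_objective is_arg_min_add_const coupled_def)
  show "is_arg_min (\<lambda>z. J z + 1 / (2 * \<mu>) * (norm z)\<^sup>2 - (transpose A *v y) \<bullet> z) (\<lambda>_. True) w"
    using w by (simp only: dual_step_objective is_arg_min_add_const)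
qed (use assms in auto)

text \<open>
  The update of \<open>p\<close> is the optimality condition of the Bregman step: with coupling it says
  \<open>p' + x' / \<mu> = A\<^sup>T y\<close>, and the dual gradient step subtracts exactly the residual term that
  coupling requires at the new point.
\<close>

lemma coupled_step:
  assumes "coupled A b \<mu> \<tau> x p y"
  shows "coupled A b \<mu> \<tau> x'
    (p - \<tau> *\<^sub>R (transpose A *v (A *v x - b)) - (1 / \<mu>) *\<^sub>R (x' - x)) (y - \<tau> *\<^sub>R (A *v x' - b))"
proof -
  have "transpose A *v (y - \<tau> *\<^sub>R (A *v x' - b))
      = transpose A *v y - \<tau> *\<^sub>R (transpose A *v (A *v x' - b))"
    by (simp only: matrix_vector_mult_diff_distrib matrix_vector_mult_scaleR)
  then show ?thesis
    using assms unfolding coupled_def by (simp add: scaleR_diff_right)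
qed

theorem theorem3p1:
  fixes J :: "real^'n \<Rightarrow> real"
    and A :: "real^'n^'m"
    and b :: "real^'m"
    and \<mu> \<tau> :: real
    and \<alpha> :: "nat \<Rightarrow> real"
    and x xt p pt w :: "nat \<Rightarrow> real^'n"
    and y yt :: "nat \<Rightarrow> real^'m"
  assumes "continuous_on UNIV J"
    and "convex_on UNIV J"
    and "\<mu> > 0"
    and "\<tau> > 0"
    and "accelerated_linearized_bregman J A b \<mu> \<tau> \<alpha> x xt p pt"
    and "accelerated_dual_gradient_descent J A b \<mu> \<tau> \<alpha> w y yt"
  shows "\<forall>k\<ge>1. x k = w k"
proof -
  note bregman = assms(5)[unfolded accelerated_linearized_bregman_def]
  note dual = assms(6)[unfolded accelerated_dual_gradient_descent_def]
  have step: "x (Suc k) = w (Suc k)" if "coupled A b \<mu> \<tau> (xt k) (pt k) (yt k)" for k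
    using coupled_minimizers_eq[OF assms(2,3) that] bregman dual by blast
  have inv: "coupled A b \<mu> \<tau> (x k) (p k) (y k) \<and> coupled A b \<mu> \<tau> (xt k) (pt k) (yt k)" for k
  proof (induction k)
    case 0
    \<comment> \<open>The start \<open>\<tau> b\<close> of the dual method is what makes the zero primal start coupled to it.\<close>
    have "coupled A b \<mu> \<tau> 0 0 (\<tau> *\<^sub>R b)"
      using matrix_vector_mult_diff_distrib[of "transpose A" 0 b]
      by (simp add: coupled_def matrix_vector_mult_scaleR)
    then show ?case
      using bregman dual by simp
  next
    case (Suc k)
    have cur: "coupled A b \<mu> \<tau> (x (Suc k)) (p (Suc k)) (y (Suc k))"
      using coupled_step[of A b \<mu> \<tau> "xt k" "pt k" "yt k" "x (Suc k)"] Suc.IH step bregman dual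
      by metis
    then show ?case
      using coupled_affine_combination[OF cur, of "x k" "p k" "y k" "\<alpha> k"] Suc.IH bregman dual
      by metis
  qed
  have "x (Suc k) = w (Suc k)" for k
    using step inv by blast
  then show ?thesis
    by (metis One_nat_def Suc_le_D)
qed

end
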